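(* For all integers $q \ge d \ge c \ge 1$, $B(q,d,c) \le p(q,d,c)$, where $p(q,d,c)$ is the smallest prime number that is at least $\left\lceil \frac{q-c+1}{d-c+1}\right\rceil$. That is, every $f:\binom{[q]}{d}\to[c]$ has a $p(q,d,c)$-cover.
   Context: $\binom{[q]}{d}$ denotes the family of $d$-element subsets of $[q]=\{1,\dots,q\}$. A function $f:\binom{[q]}{d}\to[c]$ has a $t$-cover if there exist $S_1,\dots,S_t\in\binom{[q]}{d}$ (not necessarily distinct) with $S_1\cup\dots\cup S_t=[q]$ and $f(S_1)=\dots=f(S_t)$. $B(q,d,c)$ is the minimum $t$ such that every $f:\binom{[q]}{d}\to[c]$ has a $t$-cover. *)

theory Defs
  imports Complex_Main "HOL-Computational_Algebra.Primes"
begin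

definition dsubsets :: "nat \<Rightarrow> nat \<Rightarrow> nat set set" where
  "dsubsets q d = {S. S \<subseteq> {1..q} \<and> card S = d}"

definition has_cover :: "nat \<Rightarrow> nat \<Rightarrow> (nat set \<Rightarrow> nat) \<Rightarrow> nat \<Rightarrow> bool" where
  "has_cover q d f t \<longleftrightarrow>
     (\<exists>S :: nat \<Rightarrow> nat set. (\<forall>i\<in>{1..t}. S i \<in> dsubsets q d) \<and>
        (\<Union>i\<in>{1..t}. S i) = {1..q} \<and>
        (\<forall>i\<in>{1..t}. \<forall>j\<in>{1..t}. f (S i) = f (S j)))"

definition B :: "nat \<Rightarrow> nat \<Rightarrow> nat \<Rightarrow> nat" where
  "B q d c = (LEAST t. \<forall>f. (\<forall>S\<in>dsubsets q d. f S \<in> {1..c}) \<longrightarrow> has_cover q d f t)"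

definition p :: "nat \<Rightarrow> nat \<Rightarrow> nat \<Rightarrow> nat" where
  "p q d c = (LEAST r. prime r \<and>
      real r \<ge> real_of_int (ceiling ((real q - real c + 1) / (real d - real c + 1))))"

end

theory Submission
  imports Defs "HOL-Number_Theory.Cong"
begin

text \<open>
  Write \<open>r = p q d c\<close> and pass to complements: a cover by \<open>r\<close> sets is a family of \<open>r\<close> sets of size
  \<open>q - d\<close> with empty common intersection. Suppose that none of them is monochromatic. The proof is
  in the style of Sarkaria: a simplex \<open>x\<close> of the \<open>q * (r - 1)\<close>-fold join of the discrete
  space \<open>\<int>/r\<close> has \<open>r - 1\<close> coordinates for each point of \<open>{1..q}\<close>, and so defines sets
  \<open>A\<^sub>0, \<dots>, A\<^bsub>r-1\<^esub>\<close> with empty common intersection. If no \<open>A\<^sub>g\<close> contains a set of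
  size \<open>q - d\<close>, then the \<open>A\<^sub>g\<close> have total size at most \<open>r * (q - d - 1)\<close>. Otherwise the pairs
  (colour, \<open>g\<close>) such that \<open>A\<^sub>g\<close> contains a set of that colour form a nonempty set, and
  for each colour some \<open>g\<close> is missing, so there are at most \<open>c * (r - 1)\<close> pairs. Recording these sizes
  together with an equivariant sign (this uses that \<open>r\<close> is prime) gives an equivariant monotone map
  from the face poset to an ordinal sum of \<open>r * (q - d - 1) + c * (r - 1) < q * (r - 1)\<close> copies
  of the antichain \<open>\<int>/r\<close>.

  Such a map does not exist, by a mod \<open>r\<close> form of Dold's theorem. In the source there are chains
  \<open>h\<^sub>0, h\<^sub>1, \<dots>\<close>, each obtained by coning off the previous one, with boundaries alternately
  \<open>(\<nu> - 1) h\<close> and \<open>(1 + \<nu> + \<dots> + \<nu>\<^bsup>r-1\<^esup>) h\<close> for the generator \<open>\<nu>\<close> of \<open>\<int>/r\<close>. In the target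
  there are cochains, dual to them, that evaluate to \<open>1\<close> modulo \<open>r\<close> on the images of these chains, but
  vanish for dimension reasons.
\<close>

section \<open>Cochains on lists\<close>

text \<open>Cochains are functions on lists; the empty list plays the role of the augmentation.\<close>

fun cobd :: "('a list \<Rightarrow> int) \<Rightarrow> 'a list \<Rightarrow> int" where
  "cobd \<psi> [] = 0"
| "cobd \<psi> (x # xs) = \<psi> xs - cobd (\<lambda>l. \<psi> (x # l)) xs"

text \<open>Dual to the prism over a simplex, for the homotopy from the identity to
  \<open>a\<close>: a signed sum over the place where \<open>a\<close> starts to act, with both
  \<open>x\<close> and \<open>a x\<close> kept there.\<close>

fun prism :: "('a \<Rightarrow> 'a) \<Rightarrow> ('a list \<Rightarrow> int) \<Rightarrow> 'a list \<Rightarrow> int" where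
  "prism a \<psi> [] = 0"
| "prism a \<psi> (x # xs) = \<psi> (x # a x # map a xs) - prism a (\<lambda>l. \<psi> (x # l)) xs"

text \<open>Contraction in two stages: the prism moves \<open>x\<close> to \<open>a x\<close>, then
  everything is joined to \<open>z\<close>. It is applied along
  \<open>x \<subseteq> insert (n, 0) x \<supseteq> {(n, 0)}\<close>.\<close>

definition cone :: "('a \<Rightarrow> 'a) \<Rightarrow> 'a \<Rightarrow> ('a list \<Rightarrow> int) \<Rightarrow> 'a list \<Rightarrow> int" where
  "cone a z \<psi> xs = \<psi> (z # map a xs) - prism a \<psi> xs"

lemma cobd_diff: "cobd (\<lambda>l. \<psi> l - \<phi> l) xs = cobd \<psi> xs - cobd \<phi> xs"
  by (induction xs arbitrary: \<psi> \<phi>) auto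

lemma cobd_zero: "cobd (\<lambda>l. 0) xs = 0"
  by (induction xs) auto

lemma cobd_sum: "cobd (\<lambda>l. \<Sum>j\<in>J. \<psi> j l) xs = (\<Sum>j\<in>J. cobd (\<psi> j) xs)"
  by (induction xs arbitrary: \<psi>) (auto simp: sum_subtractf)

lemma cobd_map: "cobd (\<lambda>l. \<psi> (map f l)) xs = cobd \<psi> (map f xs)"
  by (induction xs arbitrary: \<psi>) (auto simp: o_def)

lemma cobd_cobd: "cobd (cobd \<psi>) xs = 0"
  by (induction xs arbitrary: \<psi>) (auto simp: cobd_diff)

lemma cobd_cong_mod:
  assumes "\<And>l. set l \<subseteq> set xs \<Longrightarrow> [\<psi> l = \<phi> l] (mod m)"
  shows "[cobd \<psi> xs = cobd \<phi> xs] (mod m)"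
  using assms
proof (induction xs arbitrary: \<psi> \<phi>)
  case (Cons x xs)
  have "[\<psi> xs = \<phi> xs] (mod m)" by (rule Cons.prems) auto
  moreover have "[cobd (\<lambda>l. \<psi> (x # l)) xs = cobd (\<lambda>l. \<phi> (x # l)) xs] (mod m)"
    by (rule Cons.IH, rule Cons.prems) auto
  ultimately show ?case by (auto intro: cong_diff)
qed auto

text \<open>Deleting either of two equal neighbours gives the same list with opposite signs; every
  other deletion keeps a repetition.\<close>

lemma cobd_eq_0_if_not_distinct_adj:
  assumes "\<And>l. \<not> distinct_adj l \<Longrightarrow> \<psi> l = 0" and "\<not> distinct_adj xs"
  shows "cobd \<psi> xs = 0"
  using assms
proof (induction xs arbitrary: \<psi>)
  case (Cons x xs)
  then obtain y ys where xs: "xs = y # ys" by (cases xs) auto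
  show ?case
  proof (cases "x = y")
    case True
    then have "(\<lambda>l. \<psi> (x # y # l)) = (\<lambda>l. 0)" by (intro ext Cons.prems(1)) simp
    then show ?thesis using True by (simp add: xs cobd_zero)
  next
    case False
    then have nd: "\<not> distinct_adj xs" using Cons.prems(2) xs by simp
    have "cobd (\<lambda>l. \<psi> (x # l)) xs = 0"
      by (rule Cons.IH[OF _ nd], rule Cons.prems(1)) (metis distinct_adj_ConsD)
    then show ?thesis using Cons.prems(1)[OF nd] by simp
  qed
qed auto

lemma prism_diff: "prism a (\<lambda>l. \<psi> l - \<phi> l) xs = prism a \<psi> xs - prism a \<phi> xs"
  by (induction xs arbitrary: \<psi> \<phi>) auto

lemma prism_homotopy: "prism a (cobd \<psi>) xs + cobd (prism a \<psi>) xs = \<psi> (map a xs) - \<psi> xs"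
proof (induction xs arbitrary: \<psi>)
  case (Cons x r)
  have "cobd (\<lambda>l. \<psi> (x # a x # map a l)) r = cobd (\<lambda>l. \<psi> (x # a x # l)) (map a r)"
    by (rule cobd_map)
  then show ?case using Cons.IH[of "\<lambda>l. \<psi> (x # l)"]
    by (simp add: cobd_diff prism_diff)
qed auto

text \<open>Dually, \<open>cone\<close> is a contracting homotopy, empty list included, so a cycle
  is the boundary of its cone.\<close>

lemma cone_cobd: "cone a z (cobd \<psi>) xs = \<psi> xs - cobd (cone a z \<psi>) xs"
  using prism_homotopy[of a \<psi> xs] cobd_map[of "\<lambda>l. \<psi> (z # l)" a xs]
  unfolding cone_def by (simp add: cobd_diff)

lemma cone_diff: "cone a z (\<lambda>l. \<psi> l - \<phi> l) xs = cone a z \<psi> xs - cone a z \<phi> xs"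
  by (simp add: cone_def prism_diff)

lemma prism_cong_mod:
  assumes "\<And>us x vs. xs = us @ x # vs \<Longrightarrow>
    [\<psi> (us @ x # a x # map a vs) = \<phi> (us @ x # a x # map a vs)] (mod m)"
  shows "[prism a \<psi> xs = prism a \<phi> xs] (mod m)"
  using assms
proof (induction xs arbitrary: \<psi> \<phi>)
  case (Cons x xs)
  have "[\<psi> (x # a x # map a xs) = \<phi> (x # a x # map a xs)] (mod m)"
    using Cons.prems[of "[]" x xs] by simp
  moreover have "[prism a (\<lambda>l. \<psi> (x # l)) xs = prism a (\<lambda>l. \<phi> (x # l)) xs] (mod m)"
  proof (rule Cons.IH)
    fix us y vs assume "xs = us @ y # vs"
    then show "[\<psi> (x # us @ y # a y # map a vs) = \<phi> (x # us @ y # a y # map a vs)] (mod m)"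
      using Cons.prems[of "x # us" y vs] by simp
  qed
  ultimately show ?case by (auto intro: cong_diff)
qed auto

section \<open>The alternating operators of a cyclic group action\<close>

definition twist :: "('a \<Rightarrow> 'a) \<Rightarrow> nat \<Rightarrow> nat \<Rightarrow> ('a list \<Rightarrow> int) \<Rightarrow> 'a list \<Rightarrow> int" where
  "twist \<nu> r n \<psi> l =
    (if n = 0 then \<psi> l
     else if odd n then \<psi> (map \<nu> l) - \<psi> l
     else (\<Sum>j<r. \<psi> (map (\<nu> ^^ j) l)))"

lemma twist_diff: "twist \<nu> r n (\<lambda>l. \<psi> l - \<phi> l) xs = twist \<nu> r n \<psi> xs - twist \<nu> r n \<phi> xs"
  by (auto simp: twist_def sum_subtractf)

lemma cobd_twist: "cobd (twist \<nu> r n \<psi>) xs = twist \<nu> r n (cobd \<psi>) xs"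
proof -
  consider "n = 0" | "n > 0" "odd n" | "n > 0" "even n" by auto
  then show ?thesis
    by cases (auto simp: twist_def[abs_def] cobd_diff cobd_sum cobd_map)
qed

text \<open>In either order, the difference operator times the orbit sum telescopes. Level 0 is
  excluded because \<open>twist\<close> is the identity there.\<close>

lemma twist_twist:
  assumes "n > 0" and "map (\<nu> ^^ r) l = l"
  shows "twist \<nu> r n (twist \<nu> r (Suc n) \<psi>) l = 0"
proof -
  have tele: "(\<Sum>j<r. \<psi> (map (\<nu> ^^ Suc j) l)) - (\<Sum>j<r. \<psi> (map (\<nu> ^^ j) l)) = 0"
    unfolding sum_subtractf[symmetric]
    by (subst sum_lessThan_telescope) (simp add: assms(2))
  have f1: "(\<nu> ^^ j) \<circ> \<nu> = \<nu> ^^ Suc j" for j by (simp only: funpow_Suc_right)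
  have f2: "\<nu> \<circ> (\<nu> ^^ j) = \<nu> ^^ Suc j" for j by simp
  show ?thesis using assms(1) tele
    by (simp add: twist_def f1 f2 sum_subtractf del: funpow.simps)
qed

section \<open>The join of copies of a cyclic group\<close>

text \<open>The group element is the second component. A face is a partial function from coordinates
  to group elements, given by its graph.\<close>

definition rot :: "nat \<Rightarrow> nat \<times> nat \<Rightarrow> nat \<times> nat" where
  "rot r = (\<lambda>(i, g). (i, Suc g mod r))"

lemma rot_funpow: "g < r \<Longrightarrow> (rot r ^^ j) (i, g) = (i, (g + j) mod r)"
  by (induction j) (auto simp: rot_def mod_Suc_eq)

definition faces :: "nat \<Rightarrow> nat \<Rightarrow> (nat \<times> nat) set set" where
  "faces r n = {x. x \<noteq> {} \<and> x \<subseteq> {..<n} \<times> {..<r} \<and> inj_on fst x}"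

text \<open>One \<open>n\<close> serves as length and as number of coordinates, since every cone
  adds one entry and one fresh coordinate.\<close>

definition chains :: "nat \<Rightarrow> nat \<Rightarrow> (nat \<times> nat) set list set" where
  "chains r n = {l. sorted_wrt (\<subseteq>) l \<and> length l = n \<and> set l \<subseteq> faces r n}"

lemma rot_faces: "x \<in> faces r n \<Longrightarrow> rot r ` x \<in> faces r n"
proof -
  assume x: "x \<in> faces r n"
  have "inj_on fst (rot r ` x)"
  proof (rule inj_onI, elim imageE)
    fix u v y z assume "u = rot r y" "v = rot r z" "y \<in> x" "z \<in> x" "fst u = fst v"
    moreover from this have "y = z"
      using x by (intro inj_onD[of fst x]) (auto simp: faces_def rot_def split: prod.splits)
    ultimately show "u = v" by simp
  qed
  moreover have "rot r y \<in> {..<n} \<times> {..<r}" if "y \<in> x" for y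
    using that x by (cases y, cases "r = 0") (auto simp: faces_def rot_def)
  then have "rot r ` x \<subseteq> {..<n} \<times> {..<r}" by (rule image_subsetI)
  ultimately show ?thesis using x by (simp add: faces_def)
qed

lemma image_funpow: "((`) f ^^ j) A = (f ^^ j) ` A" for f :: "'a \<Rightarrow> 'a"
  by (induction j) (auto simp: image_comp)

lemma rot_faces_period: "x \<in> faces r n \<Longrightarrow> ((`) (rot r) ^^ r) x = x"
proof -
  assume x: "x \<in> faces r n"
  have "(rot r ^^ r) y = y" if "y \<in> x" for y
    using that x by (cases y) (auto simp: faces_def rot_funpow)
  then show ?thesis by (simp add: image_funpow)
qed

lemma rot_chains:
  assumes "l \<in> chains r n" shows "map ((`) (rot r) ^^ j) l \<in> chains r n"
proof -
  have "((`) (rot r) ^^ j) x \<in> faces r n" if "x \<in> faces r n" for x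
    using that by (induction j) (auto intro: rot_faces)
  moreover have "sorted_wrt (\<lambda>x y. ((`) (rot r) ^^ j) x \<subseteq> ((`) (rot r) ^^ j) y) l"
    by (rule sorted_wrt_mono_rel[of _ "(\<subseteq>)"])
      (use assms in \<open>simp_all add: chains_def image_funpow image_mono\<close>)
  ultimately show ?thesis using assms by (auto simp: chains_def sorted_wrt_map)
qed

lemma faces_insert: "x \<in> faces r n \<Longrightarrow> r > 0 \<Longrightarrow> insert (n, 0) x \<in> faces r (Suc n)"
  unfolding faces_def by (auto simp: inj_on_def less_Suc_eq)

lemma faces_Suc: "x \<in> faces r n \<Longrightarrow> x \<in> faces r (Suc n)"
  unfolding faces_def by auto

lemma faces_vertex: "r > 0 \<Longrightarrow> {(n, 0)} \<in> faces r (Suc n)"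
  unfolding faces_def by auto

lemma chains_cone:
  assumes "l \<in> chains r n" "r > 0"
  shows "{(n, 0)} # map (insert (n, 0)) l \<in> chains r (Suc n)"
proof -
  have "sorted_wrt (\<lambda>x y. insert (n, 0) x \<subseteq> insert (n, 0) y) l"
    by (rule sorted_wrt_mono_rel[of _ "(\<subseteq>)"])
      (use assms in \<open>auto simp: chains_def\<close>)
  then show ?thesis using assms
    by (auto simp: chains_def sorted_wrt_map faces_vertex intro!: faces_insert)
qed

lemma chains_prism:
  assumes "us @ x # vs \<in> chains r n" "r > 0"
  shows "us @ x # insert (n, 0) x # map (insert (n, 0)) vs \<in> chains r (Suc n)"
proof -
  have "sorted_wrt (\<lambda>x y. insert (n, 0) x \<subseteq> insert (n, 0) y) vs"
    by (rule sorted_wrt_mono_rel[of _ "(\<subseteq>)"])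
      (use assms in \<open>auto simp: chains_def sorted_wrt_append\<close>)
  then show ?thesis using assms
    by (auto simp: chains_def sorted_wrt_map sorted_wrt_append faces_Suc intro!: faces_insert)
qed

text \<open>A chain is represented by its evaluation functional on cochains. \<open>hemi r n\<close> is evaluation on the
  chain \<open>h\<^bsub>n-1\<^esub>\<close>, which consists of lists of length \<open>n\<close>.\<close>

fun hemi :: "nat \<Rightarrow> nat \<Rightarrow> ((nat \<times> nat) set list \<Rightarrow> int) \<Rightarrow> int" where
  "hemi r 0 \<psi> = \<psi> []"
| "hemi r (Suc n) \<psi> =
    hemi r n (twist ((`) (rot r)) r n (cone (insert (n, 0)) {(n, 0)} \<psi>))"

lemma hemi_diff: "hemi r n (\<lambda>l. \<psi> l - \<phi> l) = hemi r n \<psi> - hemi r n \<phi>"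
proof (induction n arbitrary: \<psi> \<phi>)
  case (Suc n)
  have "twist ((`) (rot r)) r n (cone (insert (n, 0)) {(n, 0)} (\<lambda>l. \<psi> l - \<phi> l)) =
    (\<lambda>l. twist ((`) (rot r)) r n (cone (insert (n, 0)) {(n, 0)} \<psi>) l
       - twist ((`) (rot r)) r n (cone (insert (n, 0)) {(n, 0)} \<phi>) l)"
    by (auto simp: cone_diff[abs_def] twist_diff)
  then show ?case by (simp add: Suc.IH)
qed auto

lemma hemi_cong_mod:
  assumes "\<And>l. l \<in> chains r n \<Longrightarrow> [\<psi> l = \<phi> l] (mod m)" and "r > 0"
  shows "[hemi r n \<psi> = hemi r n \<phi>] (mod m)"
  using assms(1)
proof (induction n arbitrary: \<psi> \<phi>)
  case 0
  then show ?case by (simp add: chains_def)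
next
  case (Suc n)
  have cone: "[cone (insert (n, 0)) {(n, 0)} \<psi> l = cone (insert (n, 0)) {(n, 0)} \<phi> l] (mod m)"
    if "l \<in> chains r n" for l
    unfolding cone_def
  proof (intro cong_diff prism_cong_mod Suc.prems)
    show "{(n, 0)} # map (insert (n, 0)) l \<in> chains r (Suc n)"
      using chains_cone that assms(2) by blast
  next
    fix us x vs assume "l = us @ x # vs"
    then show "us @ x # insert (n, 0) x # map (insert (n, 0)) vs \<in> chains r (Suc n)"
      using chains_prism that assms(2) by blast
  qed
  show ?case
    unfolding hemi.simps
  proof (rule Suc.IH)
    fix l assume l: "l \<in> chains r n"
    have "map ((`) (rot r)) l \<in> chains r n" using rot_chains[OF l, of 1] by simp
    then show "[twist ((`) (rot r)) r n (cone (insert (n, 0)) {(n, 0)} \<psi>) l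
      = twist ((`) (rot r)) r n (cone (insert (n, 0)) {(n, 0)} \<phi>) l] (mod m)"
      unfolding twist_def using cone[OF l] cone[OF rot_chains[OF l]] cone
      by (auto intro: cong_diff cong_sum)
  qed
qed

lemma hemi_eq_0:
  assumes "\<And>l. l \<in> chains r n \<Longrightarrow> \<psi> l = 0" and "r > 0"
  shows "hemi r n \<psi> = 0"
proof -
  \<comment> \<open>Congruence modulo 0 is equality, and \<open>hemi_diff\<close> sends
    \<open>\<psi> - \<psi>\<close> to 0.\<close>
  have "[hemi r n \<psi> = hemi r n (\<lambda>l. \<psi> l - \<psi> l)] (mod 0)"
    by (rule hemi_cong_mod) (use assms in auto)
  then show ?thesis unfolding hemi_diff by simp
qed

text \<open>The boundary formula: the twisted chain is a cycle because consecutive twists cancel, so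
  by \<open>cone_cobd\<close> it is the boundary of its cone.\<close>

lemma hemi_cobd:
  assumes "r > 0"
  shows "hemi r (Suc n) (cobd \<psi>) = hemi r n (twist ((`) (rot r)) r n \<psi>)"
proof (induction n arbitrary: \<psi>)
  case 0
  then show ?case by (simp add: twist_def cone_def)
next
  case (Suc n)
  let ?T = "twist ((`) (rot r)) r"
  let ?c = "cone (insert (Suc n, 0)) {(Suc n, 0)}"
  have "?T (Suc n) (?c (cobd \<psi>)) = (\<lambda>l. ?T (Suc n) \<psi> l - cobd (?T (Suc n) (?c \<psi>)) l)"
    by (auto simp: cone_cobd[abs_def] twist_diff cobd_twist)
  then have "hemi r (Suc (Suc n)) (cobd \<psi>) =
      hemi r (Suc n) (?T (Suc n) \<psi>) - hemi r (Suc n) (cobd (?T (Suc n) (?c \<psi>)))"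
    by (subst hemi.simps) (simp only: hemi_diff)
  also have "hemi r (Suc n) (cobd (?T (Suc n) (?c \<psi>))) = hemi r n (?T n (?T (Suc n) (?c \<psi>)))"
    by (rule Suc.IH)
  also have "\<dots> = 0"
  proof (rule hemi_eq_0[OF _ assms])
    fix l assume l: "l \<in> chains r n"
    show "?T n (?T (Suc n) (?c \<psi>)) l = 0"
    proof (cases "n = 0")
      case True
      then show ?thesis using l by (simp add: twist_def chains_def)
    next
      case False
      have "map ((`) (rot r) ^^ r) l = l"
        using l rot_faces_period by (intro map_idI) (auto simp: chains_def simp del: funpow.simps)
      then show ?thesis using False by (intro twist_twist) auto
    qed
  qed
  finally show ?case by simp
qed

section \<open>The obstruction cochains\<close>

text \<open>The obstruction cochains are \<open>cobd (prim r n)\<close>; each \<open>prim r (Suc n)\<close> is a primitive modulo \<open>r\<close>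
  of \<open>cobd (prim r n)\<close> under \<open>\<nu> - 1\<close> or \<open>1 + \<nu> + \<dots> + \<nu>\<^bsup>r-1\<^esup>\<close>, chosen by normalising the first entry.\<close>

fun prim :: "nat \<Rightarrow> nat \<Rightarrow> (nat \<times> nat) list \<Rightarrow> int" where
  "prim r 0 l = (if l = [] then 1 else 0)"
| "prim r (Suc n) l =
    (if l = [] then 0
     else if even n then - (\<Sum>j<r - snd (hd l). cobd (prim r n) (map (rot r ^^ j) l))
     else if snd (hd l) = 0 then cobd (prim r n) l else 0)"

lemma map_rot_period:
  assumes "snd ` set l \<subseteq> {..<r}" shows "map (rot r ^^ r) l = l"
  using assms by (intro map_idI) (auto simp: rot_funpow)

lemma map_rot_less:
  assumes "snd ` set l \<subseteq> {..<r}" shows "snd ` set (map (rot r ^^ j) l) \<subseteq> {..<r}"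
proof (cases "r = 0")
  case False
  then show ?thesis using assms by (auto simp: rot_funpow)
qed (use assms in auto)

text \<open>Partial orbit sums, cut just before the first entry wraps to group element 0, telescope.
  At the wrap the whole orbit sum appears, which vanishes by hypothesis.\<close>

lemma tau_primitive:
  fixes \<Phi> :: "(nat \<times> nat) list \<Rightarrow> int" and r :: nat
  defines "\<Psi> \<equiv> \<lambda>l. - (\<Sum>j<r - snd (hd l). \<Phi> (map (rot r ^^ j) l))"
  assumes "l \<noteq> []" and l: "snd ` set l \<subseteq> {..<r}"
    and "[(\<Sum>j<r. \<Phi> (map (rot r ^^ j) l)) = 0] (mod m)"
  shows "[\<Psi> (map (rot r) l) - \<Psi> l = \<Phi> l] (mod m)"
proof -
  define s where "s j = \<Phi> (map (rot r ^^ j) l)" for j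
  define g where "g = snd (hd l)"
  have g: "g < r" using assms(2) l by (cases l) (auto simp: g_def)
  have hd: "snd (hd (map (rot r) l)) = Suc g mod r"
    using assms(2) by (cases l) (auto simp: g_def rot_def split: prod.splits)
  have sh: "map (rot r ^^ j) (map (rot r) l) = map (rot r ^^ Suc j) l" for j
    by (simp only: map_map funpow_Suc_right)
  have 1: "\<Psi> (map (rot r) l) = - (\<Sum>j<r - Suc g mod r. s (Suc j))"
    unfolding \<Psi>_def hd s_def sh ..
  have 2: "\<Psi> l = - (\<Sum>j<r - g. s j)"
    unfolding \<Psi>_def s_def g_def ..
  have s0: "s 0 = \<Phi> l" by (simp add: s_def)
  have sr: "s r = \<Phi> l" unfolding s_def by (simp only: map_rot_period[OF l])
  show ?thesis
  proof (cases "Suc g < r")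
    case True
    have "r - g = Suc (r - Suc g)" using True by simp
    then have "(\<Sum>j<r - g. s j) = s 0 + (\<Sum>j<r - Suc g. s (Suc j))"
      by (simp only: sum.lessThan_Suc_shift)
    then show ?thesis using True 1 2 s0 by simp
  next
    case False
    then have r: "r = Suc g" using g by simp
    have "(\<Sum>j<Suc r. s j) = s 0 + (\<Sum>j<r. s (Suc j))"
      by (rule sum.lessThan_Suc_shift)
    then have "(\<Sum>j<r. s (Suc j)) = (\<Sum>j<r. s j)" using s0 sr by simp
    moreover have "[(\<Sum>j<r. s j) = 0] (mod m)" using assms(4) by (simp add: s_def)
    ultimately have "[\<Psi> (map (rot r) l) = 0] (mod m)"
      unfolding 1 using r by (simp only: cong_0_iff dvd_minus_iff mod_self diff_zero)
    moreover have "\<Psi> l = - \<Phi> l" unfolding 2 using r s0 by simp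
    ultimately show ?thesis by (simp add: cong_iff_dvd_diff)
  qed
qed

text \<open>Exactly one rotation of \<open>l\<close> gives its first entry group element 0, and by
  invariance the term there is \<open>\<Phi> l\<close>.\<close>

lemma sigma_primitive:
  fixes \<Phi> :: "(nat \<times> nat) list \<Rightarrow> int" and r :: nat
  defines "\<Psi> \<equiv> \<lambda>l. if snd (hd l) = 0 then \<Phi> l else 0"
  assumes "l \<noteq> []" and l: "snd ` set l \<subseteq> {..<r}"
    and inv: "\<And>k. snd ` set k \<subseteq> {..<r} \<Longrightarrow> [\<Phi> (map (rot r) k) = \<Phi> k] (mod m)"
  shows "[(\<Sum>j<r. \<Psi> (map (rot r ^^ j) l)) = \<Phi> l] (mod m)"
proof -
  define g where "g = snd (hd l)"
  define j0 where "j0 = (if g = 0 then 0 else r - g)"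
  have g: "g < r" using assms(2) l by (cases l) (auto simp: g_def)
  have hd: "snd (hd (map (rot r ^^ j) l)) = (g + j) mod r" for j
    using assms(2) l by (cases l) (auto simp: g_def rot_funpow)
  have invj: "[\<Phi> (map (rot r ^^ j) l) = \<Phi> l] (mod m)" for j
  proof (induction j)
    case (Suc j)
    have "[\<Phi> (map (rot r) (map (rot r ^^ j) l)) = \<Phi> (map (rot r ^^ j) l)] (mod m)"
      by (rule inv[OF map_rot_less[OF l]])
    then show ?case using Suc by (auto intro: cong_trans simp: comp_def)
  qed simp
  have j0: "(g + j) mod r = 0 \<longleftrightarrow> j = j0" if "j < r" for j
  proof
    assume "(g + j) mod r = 0"
    then obtain t where t: "g + j = r * t" by (auto simp: mod_eq_0_iff_dvd)
    have "r * t < r * 2" using t that g by linarith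
    then have "t < 2" by (metis mult_less_cancel1)
    then have "t = 0 \<or> t = 1" by auto
    then show "j = j0" using t that g by (auto simp: j0_def)
  qed (use g in \<open>auto simp: j0_def split: if_splits\<close>)
  have "[(\<Sum>j<r. \<Psi> (map (rot r ^^ j) l)) = (\<Sum>j<r. if j = j0 then \<Phi> l else 0)] (mod m)"
    unfolding \<Psi>_def hd by (rule cong_sum) (use j0 invj in auto)
  moreover have "j0 < r" using g by (auto simp: j0_def)
  ultimately show ?thesis by (simp add: sum.delta)
qed

lemma prim_Suc:
  assumes "l \<noteq> []"
  shows "even n \<Longrightarrow> prim r (Suc n) l = - (\<Sum>j<r - snd (hd l). cobd (prim r n) (map (rot r ^^ j) l))"
    and "odd n \<Longrightarrow> prim r (Suc n) l = (if snd (hd l) = 0 then cobd (prim r n) l else 0)"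
  using assms by simp_all

text \<open>Applying \<open>cobd\<close> to the previous case turns its right side into
  \<open>cobd (cobd _) = 0\<close>, which supplies the hypothesis of the next primitive.\<close>

lemma twist_prim:
  assumes "snd ` set l \<subseteq> {..<r}"
  shows "[twist (rot r) r (Suc n) (prim r (Suc n)) l = cobd (prim r n) l] (mod int r)"
  using assms
proof (induction n arbitrary: l)
  case (0 l)
  show ?case
  proof (cases "l = []")
    case False
    \<comment> \<open>The initial cochain is invariant, so its orbit sum is \<open>r\<close> times a
      value; here the modulus \<open>r\<close> enters.\<close>
    have "(\<lambda>l. prim r 0 (map h l)) = prim r 0" for h by auto
    then have "cobd (prim r 0) (map h l) = cobd (prim r 0) l" for h
      using cobd_map[of "prim r 0" h l] by simp
    then have "[(\<Sum>j<r. cobd (prim r 0) (map (rot r ^^ j) l)) = 0] (mod int r)"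
      by (simp add: cong_0_iff)
    from tau_primitive[OF False 0 this] show ?thesis
      using False by (simp add: twist_def del: prim.simps(1))
  qed (simp add: twist_def)
next
  case (Suc n l)
  have *: "[twist (rot r) r (Suc n) (cobd (prim r (Suc n))) k = 0] (mod int r)"
    if "snd ` set k \<subseteq> {..<r}" for k
  proof -
    have "[cobd (twist (rot r) r (Suc n) (prim r (Suc n))) k = cobd (cobd (prim r n)) k] (mod int r)"
      by (rule cobd_cong_mod, rule Suc.IH) (use that in auto)
    then show ?thesis by (simp only: cobd_twist cobd_cobd)
  qed
  show ?case
  proof (cases "l = []")
    case False
    show ?thesis
    proof (cases "even n")
      case True
      have "[cobd (prim r (Suc n)) (map (rot r) k) = cobd (prim r (Suc n)) k] (mod int r)"
        if "snd ` set k \<subseteq> {..<r}" for k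
        using *[OF that] True by (simp add: twist_def cong_iff_dvd_diff)
      from sigma_primitive[of l r "cobd (prim r (Suc n))", OF False Suc.prems this] show ?thesis
        using False True by (simp add: twist_def prim_Suc del: prim.simps(2))
    next
      case odd: False
      have "[(\<Sum>j<r. cobd (prim r (Suc n)) (map (rot r ^^ j) l)) = 0] (mod int r)"
        using *[OF Suc.prems] odd by (simp add: twist_def)
      from tau_primitive[OF False Suc.prems this] show ?thesis
        using False odd by (simp add: twist_def prim_Suc del: prim.simps(2))
    qed
  qed (simp add: twist_def)
qed

text \<open>The cochains are normalised: they vanish on degenerate lists, as the dimension argument
  requires.\<close>

lemma prim_eq_0_if_not_distinct_adj: "\<not> distinct_adj l \<Longrightarrow> prim r n l = 0"
proof (induction n arbitrary: l)
  case 0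
  then show ?case by (cases l) auto
next
  case (Suc n)
  have "cobd (prim r n) (map h l) = 0" for h
  proof (rule cobd_eq_0_if_not_distinct_adj)
    show "\<not> distinct_adj (map h l)" using Suc.prems distinct_adj_mapD by blast
  qed (rule Suc.IH)
  from this this[of "\<lambda>x. x"] show ?case by simp
qed

section \<open>Nonexistence of equivariant monotone maps into few levels\<close>

lemma equivariant_poset_map_bound:
  fixes f :: "(nat \<times> nat) set \<Rightarrow> nat \<times> nat"
  assumes r: "r \<ge> 2"
    and range: "\<And>x. x \<in> faces r n \<Longrightarrow> fst (f x) < N" "\<And>x. x \<in> faces r n \<Longrightarrow> snd (f x) < r"
    and equivariant: "\<And>x. x \<in> faces r n \<Longrightarrow> f (rot r ` x) = rot r (f x)"
    and mono: "\<And>x y. x \<in> faces r n \<Longrightarrow> y \<in> faces r n \<Longrightarrow> x \<subseteq> y \<Longrightarrow>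
      fst (f x) < fst (f y) \<or> f x = f y"
  shows "n \<le> N"
proof (rule ccontr)
  assume "\<not> n \<le> N"
  then have "N < n" by simp
  have faces_mono: "x \<in> faces r n" if "x \<in> faces r k" "k \<le> n" for x k
    using that by (auto simp: faces_def)
  \<comment> \<open>Descent in dimension: \<open>hemi_cobd\<close> trades the coboundary for a
    twist, equivariance moves the twist past \<open>f\<close>, and \<open>twist_prim\<close> returns
    the previous cochain. It ends at a single vertex.\<close>
  have unit: "[hemi r (Suc k) (\<lambda>l. cobd (prim r k) (map f l)) = 1] (mod int r)" if "Suc k \<le> n" for k
    using that
  proof (induction k)
    case 0
    then show ?case by (simp add: twist_def cone_def)
  next
    case (Suc k)
    have eqj: "f (((`) (rot r) ^^ j) x) = (rot r ^^ j) (f x) \<and> ((`) (rot r) ^^ j) x \<in> faces r n"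
      if "x \<in> faces r n" for x j
      by (induction j) (use that equivariant rot_faces in auto)
    have "hemi r (Suc (Suc k)) (\<lambda>l. cobd (prim r (Suc k)) (map f l)) =
      hemi r (Suc k) (twist ((`) (rot r)) r (Suc k) (\<lambda>l. prim r (Suc k) (map f l)))"
      unfolding cobd_map[symmetric] by (rule hemi_cobd) (use r in simp)
    moreover have "[hemi r (Suc k) (twist ((`) (rot r)) r (Suc k) (\<lambda>l. prim r (Suc k) (map f l))) =
      hemi r (Suc k) (\<lambda>l. cobd (prim r k) (map f l))] (mod int r)"
    proof (rule hemi_cong_mod)
      fix l assume "l \<in> chains r (Suc k)"
      then have l: "set l \<subseteq> faces r n" using Suc.prems faces_mono by (force simp: chains_def)
      have "map f (map ((`) (rot r) ^^ j) l) = map (rot r ^^ j) (map f l)" for j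
        using l eqj by (auto simp: subset_iff)
      from this this[of 1]
      have "twist ((`) (rot r)) r (Suc k) (\<lambda>l. prim r (Suc k) (map f l)) l =
        twist (rot r) r (Suc k) (prim r (Suc k)) (map f l)"
        unfolding twist_def by (simp del: map_map prim.simps)
      moreover have "[twist (rot r) r (Suc k) (prim r (Suc k)) (map f l) =
          cobd (prim r k) (map f l)] (mod int r)"
        by (rule twist_prim) (use l range(2) in auto)
      ultimately show "[twist ((`) (rot r)) r (Suc k) (\<lambda>l. prim r (Suc k) (map f l)) l =
        cobd (prim r k) (map f l)] (mod int r)" by (simp only:)
    qed (use r in simp)
    ultimately show ?case using Suc.IH[OF Suc_leD[OF Suc.prems]]
      by (simp only:) (rule cong_trans)
  qed
  \<comment> \<open>A chain of \<open>N + 1\<close> faces meets only \<open>N\<close> levels, so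
    monotonicity forces two neighbours to have equal images.\<close>
  have "hemi r (Suc N) (\<lambda>l. cobd (prim r N) (map f l)) = 0"
  proof (rule hemi_eq_0)
    fix l assume l: "l \<in> chains r (Suc N)"
    have lf: "set l \<subseteq> faces r n" using l \<open>N < n\<close> faces_mono by (force simp: chains_def)
    have "\<not> distinct_adj (map f l)"
    proof
      assume "distinct_adj (map f l)"
      moreover have "sorted_wrt (\<subseteq>) l" using l by (simp add: chains_def)
      ultimately have "sorted_wrt (<) (map (\<lambda>x. fst (f x)) l)" using lf
      proof (induction l)
        case (Cons x l)
        show ?case
        proof (cases l)
          case l: (Cons y k)
          have xy: "fst (f x) < fst (f y)"
            using l Cons.prems mono[of x y] by auto
          have s: "sorted_wrt (<) (map (\<lambda>x. fst (f x)) l)"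
            by (rule Cons.IH) (use l Cons.prems in auto)
          then have "\<forall>z\<in>set k. fst (f y) < fst (f z)" by (simp add: l)
          then have "\<forall>z\<in>set l. fst (f x) < fst (f z)" using xy l by fastforce
          with s show ?thesis by simp
        qed simp
      qed simp
      then have "distinct (map (\<lambda>x. fst (f x)) l)"
        using strict_sorted_iff by blast
      then have "card ((\<lambda>x. fst (f x)) ` set l) = length l"
        using distinct_card[of "map (\<lambda>x. fst (f x)) l"] by simp
      moreover have "(\<lambda>x. fst (f x)) ` set l \<subseteq> {..<N}"
      proof (rule image_subsetI)
        fix x assume "x \<in> set l"
        then show "fst (f x) \<in> {..<N}" using lf range(1) by auto
      qed
      then have "card ((\<lambda>x. fst (f x)) ` set l) \<le> N"
        using card_mono[OF finite_lessThan] by fastforce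
      ultimately show False using l by (simp add: chains_def)
    qed
    with prim_eq_0_if_not_distinct_adj show "cobd (prim r N) (map f l) = 0"
      by (rule cobd_eq_0_if_not_distinct_adj)
  qed (use r in simp)
  with unit[of N] \<open>N < n\<close> have "[0 = 1 :: int] (mod int r)" by (simp only: Suc_leI)
  then show False using r by (simp add: cong_def)
qed

section \<open>Equivariant signs\<close>

definition proper :: "nat \<Rightarrow> (nat \<times> nat) set \<Rightarrow> bool" where
  "proper r W \<longleftrightarrow> W \<noteq> {} \<and> W \<subseteq> UNIV \<times> {..<r} \<and> (\<forall>e. Pair e -` W \<noteq> {..<r})"

text \<open>The mean modulo \<open>r\<close> of the first nonempty fibre. Properness makes the size of the fibre
  invertible modulo \<open>r\<close>.\<close>

definition sign :: "nat \<Rightarrow> (nat \<times> nat) set \<Rightarrow> nat" where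
  "sign r W = (let F = Pair (LEAST e. Pair e -` W \<noteq> {}) -` W
     in THE s. s < r \<and> [s * card F = \<Sum>F] (mod r))"

text \<open>A size strictly between 0 and the prime \<open>r\<close> is invertible modulo
  \<open>r\<close>.\<close>

lemma mean_mod_unique:
  fixes F :: "nat set"
  assumes "prime r" and F: "F \<subseteq> {..<r}" "F \<noteq> {}" "F \<noteq> {..<r}"
  shows "\<exists>!s. s < r \<and> [s * card F = \<Sum>F] (mod r)"
proof -
  have fin: "finite F" using F(1) finite_subset by blast
  have "card F < card {..<r}" using F by (intro psubset_card_mono) auto
  moreover have "card F > 0" using F(2) fin by (simp add: card_gt_0_iff)
  ultimately have "\<not> r dvd card F" by (auto dest: dvd_imp_le)
  then have "coprime r (card F)" by (rule prime_imp_coprime[OF assms(1)])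
  then have cop: "coprime (card F) r" by (simp add: ac_simps)
  obtain u where u: "[card F * u = Suc 0] (mod r)"
    using cong_solve_coprime_nat[OF cop] by auto
  have r: "r > 0" using assms(1) prime_gt_0_nat by blast
  show ?thesis
  proof (rule ex1I[of _ "(u * \<Sum>F) mod r"])
    have "[(card F * u) * \<Sum>F = Suc 0 * \<Sum>F] (mod r)" by (rule cong_scalar_right[OF u])
    moreover have "[(u * \<Sum>F) mod r * card F = (u * \<Sum>F) * card F] (mod r)"
      by (simp only: cong_def mod_mult_left_eq)
    moreover have "(u * \<Sum>F) * card F = (card F * u) * \<Sum>F" by (simp only: mult_ac)
    ultimately have "[(u * \<Sum>F) mod r * card F = \<Sum>F] (mod r)"
      by (simp only: cong_def mult_1 One_nat_def[symmetric])
    then show u': "(u * \<Sum>F) mod r < r \<and> [(u * \<Sum>F) mod r * card F = \<Sum>F] (mod r)"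
      using r by simp
    show "s = (u * \<Sum>F) mod r" if s: "s < r \<and> [s * card F = \<Sum>F] (mod r)" for s
    proof -
      have "[s * card F = (u * \<Sum>F) mod r * card F] (mod r)"
        using s u' by (simp only: cong_def)
      then have "[s = (u * \<Sum>F) mod r] (mod r)" by (simp only: cong_mult_rcancel_nat[OF cop])
      then show ?thesis using s by (simp add: cong_def)
    qed
  qed
qed

lemma inj_on_Suc_mod: "inj_on (\<lambda>g. Suc g mod r) {..<r}"
  by (rule inj_onI) (auto simp: mod_Suc split: if_splits)

lemma inj_on_rot: "inj_on (rot r) (UNIV \<times> {..<r})"
proof (rule inj_onI)
  fix x y assume "x \<in> UNIV \<times> {..<r}" "y \<in> UNIV \<times> {..<r}" "rot r x = rot r y"
  then show "x = y" using inj_onD[OF inj_on_Suc_mod[of r], of "snd x" "snd y"]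
    by (cases x, cases y) (simp add: rot_def)
qed

lemma rot_fibre: "Pair e -` (rot r ` W) = (\<lambda>g. Suc g mod r) ` (Pair e -` W)"
proof (intro set_eqI iffI)
  fix h assume "h \<in> (\<lambda>g. Suc g mod r) ` (Pair e -` W)"
  then obtain g where g: "(e, g) \<in> W" "h = Suc g mod r" by auto
  have "rot r (e, g) \<in> rot r ` W" using g(1) by (rule imageI)
  then show "h \<in> Pair e -` (rot r ` W)" using g(2) by (simp add: rot_def)
qed (auto simp: rot_def)

lemma sign_works:
  assumes "prime r" "proper r W"
  defines "F \<equiv> Pair (LEAST e. Pair e -` W \<noteq> {}) -` W"
  shows "F \<subseteq> {..<r}" "F \<noteq> {}" "F \<noteq> {..<r}"
    and "sign r W < r \<and> [sign r W * card F = \<Sum>F] (mod r)"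
proof -
  show F: "F \<subseteq> {..<r}" "F \<noteq> {..<r}" using assms(2) by (auto simp: proper_def F_def)
  obtain e g where "(e, g) \<in> W" using assms(2) by (auto simp: proper_def)
  then have "\<exists>e. Pair e -` W \<noteq> {}" by blast
  then show ne: "F \<noteq> {}" unfolding F_def by (rule LeastI_ex)
  show "sign r W < r \<and> [sign r W * card F = \<Sum>F] (mod r)"
    using theI'[OF mean_mod_unique[OF assms(1) F(1) ne F(2)]]
    by (simp only: sign_def F_def Let_def)
qed

lemma rot_proper:
  assumes "proper r W" shows "proper r (rot r ` W)"
proof -
  have "r > 0" using assms by (auto simp: proper_def)
  have "Pair e -` (rot r ` W) \<noteq> {..<r}" for e
  proof
    assume "Pair e -` (rot r ` W) = {..<r}"
    then have eq: "(\<lambda>g. Suc g mod r) ` (Pair e -` W) = {..<r}" by (simp only: rot_fibre)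
    have sub: "Pair e -` W \<subseteq> {..<r}" using assms by (auto simp: proper_def)
    have "card (Pair e -` W) = r"
      using card_image[OF inj_on_subset[OF inj_on_Suc_mod sub]] eq by simp
    then have "Pair e -` W = {..<r}" using card_subset_eq[OF _ sub] by simp
    then show False using assms by (simp add: proper_def)
  qed
  then show ?thesis using assms \<open>r > 0\<close> by (auto simp: proper_def rot_def)
qed

text \<open>Rotation raises the fibre sum by the fibre size modulo \<open>r\<close>; uniqueness of
  the mean then gives the shifted sign.\<close>

lemma sign_rot:
  assumes r: "prime r" and W: "proper r W"
  shows "sign r (rot r ` W) = Suc (sign r W) mod r"
proof -
  define F where "F = Pair (LEAST e. Pair e -` W \<noteq> {}) -` W"
  define F' where "F' = (\<lambda>g. Suc g mod r) ` F"
  note W' = rot_proper[OF W]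
  have "(LEAST e. Pair e -` (rot r ` W) \<noteq> {}) = (LEAST e. Pair e -` W \<noteq> {})"
    by (simp only: rot_fibre image_is_empty)
  then have F': "Pair (LEAST e. Pair e -` (rot r ` W) \<noteq> {}) -` (rot r ` W) = F'"
    by (simp only: rot_fibre F_def F'_def)
  note FW = sign_works[OF r W, folded F_def]
  note FW' = sign_works[OF r W', unfolded F']
  have inj: "inj_on (\<lambda>g. Suc g mod r) F" using inj_on_Suc_mod FW(1) by (rule inj_on_subset)
  have card: "card F' = card F" unfolding F'_def by (rule card_image[OF inj])
  have "\<Sum>F' = (\<Sum>g\<in>F. Suc g mod r)" unfolding F'_def by (simp add: sum.reindex[OF inj])
  also have "[(\<Sum>g\<in>F. Suc g mod r) = (\<Sum>g\<in>F. Suc g)] (mod r)" by (rule cong_sum) (simp add: cong_def)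
  finally have "[\<Sum>F' = \<Sum>F + card F] (mod r)" by (simp add: sum_Suc)
  moreover have "[Suc (sign r W) mod r * card F = sign r W * card F + card F] (mod r)"
    by (simp add: cong_def mod_mult_left_eq add.commute)
  moreover have "[sign r W * card F + card F = \<Sum>F + card F] (mod r)"
    using FW(4) by (simp add: cong_add_rcancel_nat)
  ultimately have "[Suc (sign r W) mod r * card F' = \<Sum>F'] (mod r)"
    unfolding card by (simp only: cong_def)
  moreover have "Suc (sign r W) mod r < r" using prime_gt_0_nat[OF r] by simp
  ultimately show ?thesis
    using mean_mod_unique[OF r FW'(1-3)] FW'(4) by blast
qed

lemma card_rot: "W \<subseteq> UNIV \<times> {..<r} \<Longrightarrow> card (rot r ` W) = card W"
  by (rule card_image[OF inj_on_subset[OF inj_on_rot]])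

lemma rot_layer:
  assumes "W \<subseteq> UNIV \<times> {..<r}" "g < r"
  shows "{e. (e, Suc g mod r) \<in> rot r ` W} = {e. (e, g) \<in> W}"
proof -
  have "(e, Suc g mod r) \<in> rot r ` W \<longleftrightarrow> (e, g) \<in> W" for e
    using inj_on_image_mem_iff[OF inj_on_rot, of "(e, g)" r W] assms by (simp add: rot_def)
  then show ?thesis by simp
qed

section \<open>From colourings to equivariant maps\<close>

definition shadow :: "nat \<Rightarrow> (nat set \<Rightarrow> nat \<Rightarrow> bool) \<Rightarrow> (nat \<times> nat) set \<Rightarrow> (nat \<times> nat) set" where
  "shadow r P W = {(k, g). g < r \<and> (\<exists>A \<subseteq> {e. (e, g) \<in> W}. P A k)}"

lemma shadow_mono: "W \<subseteq> W' \<Longrightarrow> shadow r P W \<subseteq> shadow r P W'"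
  unfolding shadow_def by blast

lemma shadow_rot:
  assumes "W \<subseteq> UNIV \<times> {..<r}"
  shows "shadow r P (rot r ` W) = rot r ` shadow r P W"
proof -
  have iff: "(k, Suc g mod r) \<in> shadow r P (rot r ` W) \<longleftrightarrow> (k, g) \<in> shadow r P W" if "g < r" for k g
    using that by (simp add: shadow_def rot_layer[OF assms that])
  show ?thesis
  proof (intro set_eqI iffI)
    fix y assume y: "y \<in> shadow r P (rot r ` W)"
    obtain k h where kh: "y = (k, h)" by (cases y)
    then have "h < r" using y by (simp add: shadow_def)
    define g where "g = (if h = 0 then r - 1 else h - 1)"
    have g: "g < r" "h = Suc g mod r" using \<open>h < r\<close> by (auto simp: g_def)
    then have "(k, g) \<in> shadow r P W" using y iff by (simp add: kh)
    then have "rot r (k, g) \<in> rot r ` shadow r P W" by (rule imageI)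
    then show "y \<in> rot r ` shadow r P W" by (simp add: kh g rot_def)
  next
    fix y assume "y \<in> rot r ` shadow r P W"
    then obtain k g where kg: "(k, g) \<in> shadow r P W" and y: "y = (k, Suc g mod r)"
      by (auto simp: rot_def)
    have "g < r" using kg by (simp add: shadow_def)
    then show "y \<in> shadow r P (rot r ` W)" using kg iff y by simp
  qed
qed

text \<open>Each fibre misses at least one group element.\<close>

lemma card_proper_le:
  assumes "proper r W" "W \<subseteq> I \<times> UNIV" "finite I"
  shows "card W \<le> card I * (r - 1)"
proof -
  have W: "W = Sigma I (\<lambda>e. Pair e -` W)" using assms(2) by auto
  have fin: "finite (Pair e -` W)" for e
    by (rule finite_subset[of _ "{..<r}"]) (use assms(1) in \<open>auto simp: proper_def\<close>)
  have "card (Pair e -` W) \<le> r - 1" for e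
  proof -
    have "Pair e -` W \<subset> {..<r}" using assms(1) by (auto simp: proper_def)
    then have "card (Pair e -` W) < card {..<r}" by (intro psubset_card_mono) auto
    then show ?thesis by simp
  qed
  then have "(\<Sum>e\<in>I. card (Pair e -` W)) \<le> card I * (r - 1)"
    using sum_bounded_above[of I "\<lambda>e. card (Pair e -` W)" "r - 1"] by simp
  moreover have "card W = (\<Sum>e\<in>I. card (Pair e -` W))"
    by (subst W, rule card_SigmaI) (use assms(3) fin in auto)
  ultimately show ?thesis by simp
qed

text \<open>Collapsing each block of \<open>r - 1\<close> coordinates to a point of \<open>{1..q}\<close> leaves every point with at most
  \<open>r - 1\<close> group elements, whence properness.\<close>

definition block :: "nat \<Rightarrow> (nat \<times> nat) set \<Rightarrow> (nat \<times> nat) set" where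
  "block r x = (\<lambda>(i, g). (Suc (i div (r - 1)), g)) ` x"

lemma block_rot: "block r (rot r ` x) = rot r ` block r x"
  by (force simp: block_def rot_def)

lemma block_subset:
  assumes "x \<in> faces r (q * (r - 1))"
  shows "block r x \<subseteq> {1..q} \<times> {..<r}"
proof
  fix y assume "y \<in> block r x"
  then obtain i g where "(i, g) \<in> x" and y: "y = (Suc (i div (r - 1)), g)" by (auto simp: block_def)
  then have "i < q * (r - 1)" "g < r" using assms by (auto simp: faces_def)
  then show "y \<in> {1..q} \<times> {..<r}" using y by (auto simp: less_mult_imp_div_less Suc_leI)
qed

lemma block_proper:
  assumes "x \<in> faces r n" "r \<ge> 2"
  shows "proper r (block r x)"
proof -
  have x: "x \<noteq> {}" "x \<subseteq> {..<n} \<times> {..<r}" "inj_on fst x" using assms(1) by (auto simp: faces_def)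
  have "Pair e -` block r x \<noteq> {..<r}" for e
  proof
    assume eq: "Pair e -` block r x = {..<r}"
    \<comment> \<open>A full fibre would need \<open>r\<close> distinct coordinates in a block of
      only \<open>r - 1\<close>; \<open>e - 1\<close> undoes the \<open>Suc\<close> in
      \<open>block\<close>.\<close>
    define y where "y = {z \<in> x. Suc (fst z div (r - 1)) = e}"
    define I where "I = {(e - 1) * (r - 1)..<(e - 1) * (r - 1) + (r - 1)}"
    have fin: "finite y" by (rule finite_subset[of _ "{..<n} \<times> {..<r}"]) (use x in \<open>auto simp: y_def\<close>)
    have "{..<r} \<subseteq> snd ` y" unfolding eq[symmetric] y_def block_def by force
    then have "r \<le> card (snd ` y)" using fin card_mono[of "snd ` y" "{..<r}"] by simp
    also have "\<dots> \<le> card y" by (rule card_image_le[OF fin])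
    also have "card y = card (fst ` y)"
      by (rule card_image[symmetric]) (rule inj_on_subset[OF x(3)], auto simp: y_def)
    also have "\<dots> \<le> card I"
    proof (rule card_mono)
      show "fst ` y \<subseteq> I"
      proof
        fix i assume "i \<in> fst ` y"
        then have "i div (r - 1) = e - 1" by (auto simp: y_def)
        then have "i = (e - 1) * (r - 1) + i mod (r - 1)" by (metis div_mult_mod_eq)
        moreover have "i mod (r - 1) < r - 1" using assms(2) by simp
        ultimately show "i \<in> I" unfolding I_def by (metis atLeastLessThan_iff le_add1 nat_add_left_cancel_less)
      qed
    qed (simp add: I_def)
    also have "\<dots> = r - 1" by (simp add: I_def)
    finally show False using assms(2) by simp
  qed
  then show ?thesis using x by (force simp: proper_def block_def)
qed

section \<open>The covering argument for \<open>d < q\<close>\<close>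

lemma has_cover_prime:
  assumes r: "prime r" and c: "c \<le> d" and dq: "d < q" and bound: "q + 1 \<le> r * (d - c + 1) + c"
    and f: "\<And>S. S \<in> dsubsets q d \<Longrightarrow> f S \<in> {1..c}"
  shows "has_cover q d f r"
proof (rule ccontr)
  assume no_cover: "\<not> has_cover q d f r"
  have r2: "r \<ge> 2" using r prime_ge_2_nat by blast
  define P where "P A k \<longleftrightarrow> A \<subseteq> {1..q} \<and> card A = q - d \<and> f ({1..q} - A) = k" for A k
  define n where "n = q * (r - 1)"
  define M where "M = r * (q - d - 1)"
  define N where "N = M + c * (r - 1)"
  define V where "V x = shadow r P (block r x)" for x
  \<comment> \<open>Levels count from 0, hence the \<open>- 1\<close>. Faces with empty shadow go
    below level \<open>M\<close>, ordered by block size; the others go from \<open>M\<close>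
    upwards, ordered by shadow size.\<close>
  define F where "F x = (if V x = {} then (card (block r x) - 1, sign r (block r x))
    else (M + card (V x) - 1, sign r (V x)))" for x
  have P_dsubset: "{1..q} - A \<in> dsubsets q d" if "P A k" for A k
  proof -
    have "card ({1..q} - A) = q - (q - d)"
      using that card_Diff_subset[of A "{1..q}"] finite_subset[of A "{1..q}"] by (simp add: P_def)
    then show ?thesis using dq by (auto simp: dsubsets_def)
  qed
  have bp: "proper r (block r x)" if "x \<in> faces r n" for x
    using block_proper that r2 by blast
  have bs: "block r x \<subseteq> {1..q} \<times> {..<r}" if "x \<in> faces r n" for x
    using block_subset that unfolding n_def by blast
  have V_sub: "V x \<subseteq> {1..c} \<times> {..<r}" for x
  proof
    fix y assume "y \<in> V x"
    then obtain k g A where "y = (k, g)" "g < r" "P A k" by (auto simp: V_def shadow_def)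
    moreover have "k \<in> {1..c}" using f[OF P_dsubset[OF \<open>P A k\<close>]] \<open>P A k\<close> by (simp add: P_def)
    ultimately show "y \<in> {1..c} \<times> {..<r}" by simp
  qed
  have V_proper: "proper r (V x)" if x: "x \<in> faces r n" and ne: "V x \<noteq> {}" for x
  proof -
    have "Pair k -` V x \<noteq> {..<r}" for k
    proof
      \<comment> \<open>Each layer then contains a set whose complement has colour \<open>k\<close>.
        As the block is proper, every point lies outside some layer, so these complements form a
        cover.\<close>
      assume full: "Pair k -` V x = {..<r}"
      have "\<exists>A. A \<subseteq> {e. (e, g) \<in> block r x} \<and> P A k" if "g < r" for g
      proof -
        have "(k, g) \<in> V x" using full that by blast
        then show ?thesis by (auto simp: V_def shadow_def)
      qed
      then obtain A where A: "\<And>g. g < r \<Longrightarrow> A g \<subseteq> {e. (e, g) \<in> block r x} \<and> P (A g) k" by metis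
      \<comment> \<open>The cover is indexed from 1, the group from 0.\<close>
      define S where "S i = {1..q} - A (i - 1)" for i
      have PA: "P (A (i - 1)) k" if "i \<in> {1..r}" for i using A[of "i - 1"] that by auto
      have "has_cover q d f r"
        unfolding has_cover_def
      proof (intro exI[of _ S] conjI ballI)
        show "S i \<in> dsubsets q d" if "i \<in> {1..r}" for i
          unfolding S_def by (rule P_dsubset[OF PA[OF that]])
        show "f (S i) = f (S j)" if "i \<in> {1..r}" "j \<in> {1..r}" for i j
          using PA[OF that(1)] PA[OF that(2)] by (simp add: S_def P_def)
        show "(\<Union>i\<in>{1..r}. S i) = {1..q}"
        proof
          show "{1..q} \<subseteq> (\<Union>i\<in>{1..r}. S i)"
          proof
            fix e assume e: "e \<in> {1..q}"
            have "Pair e -` block r x \<subseteq> {..<r}" "Pair e -` block r x \<noteq> {..<r}"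
              using bp[OF x] by (auto simp: proper_def)
            then obtain g where g: "g < r" "(e, g) \<notin> block r x" by blast
            then have "e \<notin> A g" using A by blast
            then have "e \<in> S (Suc g)" using e by (simp add: S_def)
            then show "e \<in> (\<Union>i\<in>{1..r}. S i)" using g(1) by (intro UN_I[of "Suc g"]) auto
          qed
        qed (auto simp: S_def)
      qed
      then show False using no_cover by simp
    qed
    moreover have "V x \<subseteq> UNIV \<times> {..<r}" using V_sub[of x] by auto
    ultimately show ?thesis using ne by (simp add: proper_def)
  qed
  \<comment> \<open>A layer with \<open>q - d\<close> points would contain a set of that size and
    contribute its colour to the shadow.\<close>
  have small: "card (block r x) \<le> M" if x: "x \<in> faces r n" and e: "V x = {}" for x
  proof -
    define A where "A g = {e. (e, g) \<in> block r x}" for g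
    have Asub: "A g \<subseteq> {1..q}" for g using bs[OF x] by (auto simp: A_def)
    have "card (A g) \<le> q - d - 1" if "g < r" for g
    proof (rule ccontr)
      assume "\<not> card (A g) \<le> q - d - 1"
      then have "q - d \<le> card (A g)" by simp
      then obtain B where "B \<subseteq> A g" "card B = q - d" by (meson obtain_subset_with_card_n)
      then have "(f ({1..q} - B), g) \<in> V x"
        using that Asub[of g] by (auto simp: V_def shadow_def P_def A_def)
      then show False using e by simp
    qed
    then have "(\<Sum>g<r. card (A g)) \<le> M"
      using sum_bounded_above[of "{..<r}" "\<lambda>g. card (A g)" "q - d - 1"] by (simp add: M_def)
    moreover have "card (block r x) = card (Sigma {..<r} A)"
    proof (rule bij_betw_same_card[of prod.swap], rule bij_betw_imageI)
      have "g < r" if "(e, g) \<in> block r x" for e g using bs[OF x] that by auto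
      then show "prod.swap ` block r x = Sigma {..<r} A"
        by (auto simp: A_def simp del: pair_in_swap_image)
          (simp add: pair_in_swap_image)
    qed simp
    moreover have "finite (A g)" for g by (rule finite_subset[OF Asub]) simp
    then have "card (Sigma {..<r} A) = (\<Sum>g<r. card (A g))" by (simp add: card_SigmaI)
    ultimately show ?thesis by simp
  qed
  have finb: "finite (block r x)" if "x \<in> faces r n" for x
    by (rule finite_subset[OF bs[OF that]]) simp
  have finV: "finite (V x)" for x by (rule finite_subset[OF V_sub]) simp
  have cb: "card (block r x) > 0" if "x \<in> faces r n" for x
    using bp[OF that] finb[OF that] by (simp add: card_gt_0_iff proper_def)
  have cV: "card (V x) > 0" if "V x \<noteq> {}" for x using that finV by (simp add: card_gt_0_iff)
  have "n \<le> N"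
  proof (rule equivariant_poset_map_bound[OF r2])
    fix x assume x: "x \<in> faces r n"
    show "fst (F x) < N"
    proof (cases "V x = {}")
      case True
      then show ?thesis using small[OF x True] cb[OF x] by (simp add: F_def N_def)
    next
      case False
      have "card (V x) \<le> card {1..c} * (r - 1)"
        by (rule card_proper_le[OF V_proper[OF x False]]) (use V_sub in auto)
      then show ?thesis using False cV[OF False] by (simp add: F_def N_def)
    qed
    show "snd (F x) < r"
      using sign_works(4)[OF r bp[OF x]] sign_works(4)[OF r V_proper[OF x]] by (simp add: F_def)
    have V_rot: "V (rot r ` x) = rot r ` V x"
      unfolding V_def block_rot by (rule shadow_rot) (use bs[OF x] in auto)
    have cards: "card (rot r ` V x) = card (V x)" "card (rot r ` block r x) = card (block r x)"
      using V_sub[of x] bs[OF x] by (intro card_rot, auto)+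
    show "F (rot r ` x) = rot r (F x)"
    proof (cases "V x = {}")
      case True
      then show ?thesis by (simp add: F_def V_rot block_rot cards sign_rot[OF r bp[OF x]]) (simp add: rot_def)
    next
      case False
      then show ?thesis by (simp add: F_def V_rot cards sign_rot[OF r V_proper[OF x False]]) (simp add: rot_def)
    qed
  next
    fix x y assume x: "x \<in> faces r n" and y: "y \<in> faces r n" and "x \<subseteq> y"
    then have b: "block r x \<subseteq> block r y" by (auto simp: block_def)
    then have v: "V x \<subseteq> V y" unfolding V_def by (rule shadow_mono)
    \<comment> \<open>Within one range, nested sets of equal size coincide, so signs agree; passing
      between the ranges raises the level.\<close>
    consider "V y = {}" "V x = {}" | "V y \<noteq> {}" "V x = {}" | "V x \<noteq> {}" "V y \<noteq> {}" using v by blast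
    then show "fst (F x) < fst (F y) \<or> F x = F y"
    proof cases
      case 1
      have "block r x = block r y \<or> card (block r x) < card (block r y)"
        using psubset_card_mono[OF finb[OF y], of "block r x"] b by blast
      then show ?thesis using 1 cb[OF x] by (auto simp: F_def)
    next
      case 2
      then have "card (block r x) - 1 < M + card (V y) - 1"
        using small[OF x] cb[OF x] cV[of y] by linarith
      then show ?thesis using 2 by (simp add: F_def)
    next
      case 3
      have "V x = V y \<or> card (V x) < card (V y)"
        using psubset_card_mono[OF finV[of y], of "V x"] v by blast
      then show ?thesis using 3 cV[of x] by (auto simp: F_def)
    qed
  qed
  moreover have "N < n"
  proof -
    obtain a where a: "d = c + a" using le_Suc_ex[OF c] by auto
    obtain b where b: "q = d + Suc b" using less_imp_Suc_add[OF dq] by auto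
    obtain t where t: "r = Suc t" using r2 by (cases r) auto
    have "c + a + Suc b + 1 \<le> Suc t * (a + 1) + c" using bound by (simp add: a b t)
    \<comment> \<open>In these variables \<open>N = (t + 1) * b + c * t\<close> and
      \<open>n = (c + a + b + 1) * t\<close>, so \<open>N < n\<close> amounts to this
      inequality.\<close>
    then have "b + 1 \<le> t * (a + 1)" by simp
    then show ?thesis by (simp add: N_def n_def M_def a b t algebra_simps)
  qed
  ultimately show False by simp
qed

theorem theorem2p6:
  fixes q d c :: nat
  assumes "1 \<le> c" and "c \<le> d" and "d \<le> q"
  shows "(\<forall>f :: nat set \<Rightarrow> nat. (\<forall>S\<in>dsubsets q d. f S \<in> {1..c}) \<longrightarrow> has_cover q d f (p q d c))
         \<and> B q d c \<le> p q d c"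
proof -
  define x where "x = (real q - real c + 1) / (real d - real c + 1)"
  \<comment> \<open>A witness that some prime qualifies, so that the \<open>LEAST\<close> in
    \<open>p\<close> is attained.\<close>
  obtain P where "prime P" "P > nat \<lceil>x\<rceil>" using bigger_prime by blast
  then have "\<exists>r. prime r \<and> real r \<ge> real_of_int \<lceil>x\<rceil>" by (intro exI[of _ P]) linarith
  then have "prime (p q d c) \<and> real (p q d c) \<ge> real_of_int \<lceil>x\<rceil>"
    unfolding p_def x_def by (rule LeastI_ex)
  then have pr: "prime (p q d c)" and "x \<le> real (p q d c)" by linarith+
  then have "real q - real c + 1 \<le> real (p q d c) * (real d - real c + 1)"
    using assms by (simp add: x_def divide_le_eq)
  then have "real (q + 1) \<le> real (p q d c * (d - c + 1) + c)"
    using assms by (simp only: of_nat_add of_nat_mult of_nat_diff of_nat_1)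
  then have bound: "q + 1 \<le> p q d c * (d - c + 1) + c" by (simp only: of_nat_le_iff)
  have cover: "has_cover q d f (p q d c)" if "\<forall>S\<in>dsubsets q d. f S \<in> {1..c}" for f
  proof (cases "d = q")
    case True
    then show ?thesis using prime_gt_0_nat[OF pr] unfolding has_cover_def
      by (intro exI[of _ "\<lambda>_. {1..q}"]) (auto simp: dsubsets_def)
  next
    case False
    then show ?thesis using has_cover_prime[OF pr assms(2) _ bound] that assms(3) by simp
  qed
  moreover have "B q d c \<le> p q d c" unfolding B_def by (rule Least_le) (use cover in blast)
  ultimately show ?thesis by blast
qed

end
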